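(* Let $X$ be an arbitrary Ptolemy metric space. Then there exist a complete geodesic Ptolemy metric space $\hat X$ and an isometric embedding $X \to \hat X$.
   Context: Write $|xy|$ for the distance between points $x,y$ of a metric space. A metric space $X$ is called a Ptolemy metric space (or: is Ptolemy) if $|xy|\,|uv| \le |xu|\,|yv| + |xv|\,|yu|$ for all $x,y,u,v\in X$. A metric space $X$ is geodesic if for any two points $x,y\in X$ there is an isometric embedding $\gamma:[0,|xy|]\to X$ with $\gamma(0)=x$ and $\gamma(|xy|)=y$. An isometric embedding is a distance-preserving (not necessarily surjective) map. *)

theory Defs
  imports "HOL-Analysis.Analysis"
begin

definition Ptolemy :: "'a metric \<Rightarrow> bool" where
  "Ptolemy X \<longleftrightarrow>
     (\<forall>x\<in>mspace X. \<forall>y\<in>mspace X. \<forall>u\<in>mspace X. \<forall>v\<in>mspace X.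
        mdist X x y * mdist X u v \<le> mdist X x u * mdist X y v + mdist X x v * mdist X y u)"

definition isometric_embedding :: "'a metric \<Rightarrow> 'b metric \<Rightarrow> ('a \<Rightarrow> 'b) \<Rightarrow> bool" where
  "isometric_embedding X Y f \<longleftrightarrow>
     f \<in> mspace X \<rightarrow> mspace Y \<and>
     (\<forall>x\<in>mspace X. \<forall>y\<in>mspace X. mdist Y (f x) (f y) = mdist X x y)"

definition geodesic_metric :: "'a metric \<Rightarrow> bool" where
  "geodesic_metric X \<longleftrightarrow>
     (\<forall>x\<in>mspace X. \<forall>y\<in>mspace X. \<exists>\<gamma>::real \<Rightarrow> 'a.
        isometric_embedding (submetric euclidean_metric {0..mdist X x y}) X \<gamma> \<and>
        \<gamma> 0 = x \<and> \<gamma> (mdist X x y) = y)"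

text \<open>
  HOL has no existential quantifier over types, so "there is a metric space" has to name a type
  that contains its points.  For a space with points in \<open>'a\<close> we let the larger space
  have its points in \<open>nat \<Rightarrow> 'a list\<close>.  This loses no generality: if some complete geodesic
  Ptolemy space contains \<open>X\<close>, then so does one of cardinality at most
  \<open>max |X| 2\<close> to the power aleph-0 (close \<open>X\<close> under a choice of geodesics and
  under limits of Cauchy sequences, omega-1 times), and the type has at least that cardinality.
  Lists rather than elements are used to make this true also when \<open>'a\<close> is a singleton.
\<close>

end

theory Submission
  imports Defs
begin

text \<open>
  The union of \<open>X\<close> with one new point \<open>m\<close> whose distance to every \<open>z\<close> is
  \<open>(|xz| + |yz|) / 2\<close> is again a Ptolemy space, and \<open>m\<close> is a midpoint of \<open>x\<close> and
  \<open>y\<close>: the triangle and Ptolemy inequalities for distinct points are affine in the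
  distances from any single one of them, so they survive averaging, and for the same reason they
  survive limits of Cauchy sequences. Iterating both operations transfinitely gives a complete
  space in which any two points have a midpoint, and such a space is geodesic.

  The iteration is carried out on the well-founded trees whose leaves are the points of
  \<open>X\<close> and whose nodes are formal midpoints or formal limits. A well-order that puts every
  node after its children plays the role of the ordinal stages: the distance of two trees is
  computed by expanding the later one.
\<close>

section \<open>Well-founded trees and the comparison of their ranks\<close>

text \<open>
  \<open>Node False f\<close> is the midpoint of \<open>f 0\<close> and \<open>f 1\<close>, and
  \<open>Node True f\<close> the limit of \<open>f\<close>.
\<close>

datatype 'a ptree = Leaf 'a | Node bool "nat \<Rightarrow> 'a ptree"

primrec children :: "'a ptree \<Rightarrow> 'a ptree set" where
  "children (Leaf x) = {}"
| "children (Node b f) = range f"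

lemma wf_children: "wf {(s, t). s \<in> children t}"
proof -
  have "(\<forall>t. (\<forall>s. (s, t) \<in> {(s, t). s \<in> children t} \<longrightarrow> P s) \<longrightarrow> P t) \<Longrightarrow> P t"
    for P and t :: "'a ptree"
    by (induction t) auto
  then show ?thesis
    unfolding wf_def by blast
qed

text \<open>Comparison of the ordinal ranks of two trees, expressed without ordinals.\<close>

primrec rank_le :: "'a ptree \<Rightarrow> 'a ptree \<Rightarrow> bool" where
  "rank_le (Leaf x) t = True"
| "rank_le (Node b f) t = (\<forall>n. \<exists>u \<in> children t. rank_le (f n) u)"

lemma rank_le_iff: "rank_le s t \<longleftrightarrow> (\<forall>s' \<in> children s. \<exists>t' \<in> children t. rank_le s' t')"
  by (cases s) auto

lemma rank_le_refl: "rank_le s s"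
  by (induction s) auto

lemma rank_le_trans: "rank_le s t \<Longrightarrow> rank_le t u \<Longrightarrow> rank_le s u"
proof (induction s arbitrary: t u)
  case (Node b f)
  show ?case
    unfolding rank_le.simps(2)
  proof
    fix n
    obtain t' where t': "t' \<in> children t" "rank_le (f n) t'"
      using Node.prems(1) by auto
    moreover obtain u' where "u' \<in> children u" "rank_le t' u'"
      using Node.prems(2) t'(1) rank_le_iff[of t u] by blast
    ultimately show "\<exists>u' \<in> children u. rank_le (f n) u'"
      using Node.IH by blast
  qed
qed simp

text \<open>Failure of \<open>rank_le t s\<close> thus means that \<open>s\<close> has strictly
  smaller rank. If a child \<open>f n\<close> of \<open>t\<close> is below no child of
  \<open>s\<close>, the induction hypothesis puts each child of \<open>s\<close> below a child of
  \<open>f n\<close>, so \<open>rank_le s (f n)\<close>. Conversely, by induction, no tree is below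
  one of its own children.\<close>

lemma not_rank_le_iff: "\<not> rank_le t s \<longleftrightarrow> (\<exists>t' \<in> children t. rank_le s t')"
proof
  assume "\<not> rank_le t s"
  then show "\<exists>t' \<in> children t. rank_le s t'"
  proof (induction t arbitrary: s)
    case (Node b f)
    then obtain n where n: "\<forall>u \<in> children s. \<not> rank_le (f n) u"
      by auto
    with Node.IH have "rank_le s (f n)"
      by (subst rank_le_iff) blast
    then show ?case
      by auto
  qed simp
next
  have irr: "\<not> rank_le t t'" if "t' \<in> children t" for t t' :: "'a ptree"
    using that
  proof (induction t arbitrary: t')
    case (Node b f)
    then obtain n where n: "t' = f n"
      by auto
    show ?case
    proof
      assume "rank_le (Node b f) t'"
      then obtain u where "u \<in> children (f n)" "rank_le (f n) u"
        using n by auto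
      with Node.IH show False
        by blast
    qed
  qed simp
  assume "\<exists>t' \<in> children t. rank_le s t'"
  with irr show "\<not> rank_le t s"
    using rank_le_trans by blast
qed

text \<open>If \<open>Node b f\<close> is not below \<open>s\<close>, then \<open>s\<close> is below
  some child \<open>f n\<close>. The children of \<open>s\<close> are strictly below
  \<open>f n\<close>, which the induction hypothesis turns into
  \<open>rank_le s' (f n)\<close>.\<close>

lemma rank_le_linear: "rank_le s t \<or> rank_le t s"
proof (induction t arbitrary: s)
  case (Node b f)
  have "rank_le s (Node b f)" if nle: "\<not> rank_le (Node b f) s"
  proof -
    obtain u where "u \<in> children (Node b f)" "rank_le s u"
      using nle not_rank_le_iff[of "Node b f" s] by blast
    then obtain n where n: "rank_le s (f n)"
      by auto
    have "rank_le s' (f n)" if s': "s' \<in> children s" for s'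
    proof -
      obtain u where "u \<in> children (f n)" "rank_le s' u"
        using n s' rank_le_iff[of s "f n"] by blast
      then have "\<not> rank_le (f n) s'"
        using not_rank_le_iff[of "f n" s'] by blast
      then show ?thesis
        using Node.IH by blast
    qed
    then show ?thesis
      using rank_le_iff[of s "Node b f"] by (auto simp del: rank_le.simps)
  qed
  then show ?case
    by blast
qed simp

section \<open>A well-order in which children precede their nodes\<close>

definition rank_less :: "('a ptree \<times> 'a ptree) set" where
  "rank_less = {(s, t). \<not> rank_le t s}"

text \<open>Structural induction replaces induction on ordinals: \<open>A t\<close> states
  accessibility of all trees of rank at most that of \<open>t\<close>, and anything strictly below
  such a tree has rank at most that of a child of \<open>t\<close>.\<close>

lemma wf_rank_less: "wf (rank_less :: ('a ptree \<times> 'a ptree) set)"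
proof -
  define A where "A t \<longleftrightarrow> (\<forall>s. rank_le s t \<longrightarrow> s \<in> Wellfounded.acc rank_less)"
    for t :: "'a ptree"
  have step: "A t" if IH: "\<And>t'. t' \<in> children t \<Longrightarrow> A t'" for t
    unfolding A_def
  proof (intro allI impI, rule accI)
    fix s s' assume s: "rank_le s t" and "(s', s) \<in> rank_less"
    then have "\<not> rank_le s s'"
      by (simp add: rank_less_def)
    with s have "\<not> rank_le t s'"
      using rank_le_trans[of s t s'] by blast
    then obtain t' where "t' \<in> children t" "rank_le s' t'"
      using not_rank_le_iff[of t s'] by blast
    then show "s' \<in> Wellfounded.acc rank_less"
      using IH[of t'] by (simp add: A_def)
  qed
  have "A t" for t
  proof (induction t)
    case (Leaf x)
    show ?case by (rule step) simp
  next
    case (Node b f)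
    show ?case by (rule step) (use Node.IH in auto)
  qed
  then have "t \<in> Wellfounded.acc rank_less" for t :: "'a ptree"
    using rank_le_refl[of t] unfolding A_def by blast
  then show ?thesis
    by (intro acc_wfI allI)
qed

definition tie_break :: "'a ptree rel" where
  "tie_break = (SOME r. Well_order r \<and> Field r = UNIV)"

lemma tie_break: "well_order_on UNIV tie_break"
  unfolding tie_break_def using someI_ex[OF well_ordering] by metis

text \<open>Lexicographic with rank first, which puts nodes after their children. The arbitrary
  well-order \<open>tie_break\<close> only separates trees of equal rank, so that of any two
  distinct trees one is the later.\<close>

definition tprec :: "'a ptree \<Rightarrow> 'a ptree \<Rightarrow> bool" (infix "\<sqsubset>" 50) where
  "s \<sqsubset> t \<longleftrightarrow> \<not> rank_le t s \<or> rank_le s t \<and> (s, t) \<in> tie_break - Id"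

lemma tprec_irrefl: "\<not> s \<sqsubset> s"
  by (simp add: tprec_def rank_le_refl)

lemma tprec_linear: "s \<sqsubset> t \<or> s = t \<or> t \<sqsubset> s"
proof -
  have "total tie_break"
    using tie_break unfolding well_order_on_def linear_order_on_def by blast
  then show ?thesis
    unfolding tprec_def total_on_def using rank_le_linear by blast
qed

lemma tprec_trans:
  assumes "s \<sqsubset> t" "t \<sqsubset> u" shows "s \<sqsubset> u"
proof -
  have "trans (tie_break - Id :: 'a ptree rel)"
    using tie_break
    by (metis well_order_on_def linear_order_on_def partial_order_on_def preorder_on_def trans_diff_Id)
  then have "(s, u) \<in> tie_break - Id" if "(s, t) \<in> tie_break - Id" "(t, u) \<in> tie_break - Id"
    using that by (meson transE)
  then show ?thesis
    using assms rank_le_linear[of t u] rank_le_linear[of s t]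
      rank_le_trans[of s t u] rank_le_trans[of u s t] rank_le_trans[of t u s]
    unfolding tprec_def by blast
qed

lemma tprec_asym: "s \<sqsubset> t \<Longrightarrow> \<not> t \<sqsubset> s"
  using tprec_trans tprec_irrefl by blast

lemma wf_tprec: "wf {(s, t). s \<sqsubset> t}"
proof (rule wfI_min)
  fix x :: "'a ptree" and Q assume "x \<in> Q"
  \<comment> \<open>Two successive minima: \<open>z\<close> has least rank in \<open>Q\<close>, and
    \<open>w\<close> below is least for \<open>tie_break\<close> among the members of
    \<open>Q\<close> of rank at most that of \<open>z\<close>.\<close>
  then obtain z where z: "z \<in> Q" "\<And>y. (y, z) \<in> rank_less \<Longrightarrow> y \<notin> Q"
    using wfE_min[OF wf_rank_less] by metis
  then have z': "\<not> rank_le z y \<Longrightarrow> y \<notin> Q" for y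
    by (simp add: rank_less_def)
  have wf: "wf (tie_break - Id :: 'a ptree rel)"
    using tie_break unfolding well_order_on_def by blast
  have "z \<in> {y \<in> Q. rank_le y z}"
    using z(1) rank_le_refl by simp
  then obtain w where w: "w \<in> {y \<in> Q. rank_le y z}"
      "\<And>y. (y, w) \<in> tie_break - Id \<Longrightarrow> y \<notin> {y \<in> Q. rank_le y z}"
    by (rule wfE_min[OF wf]) (rule that, assumption, blast)
  have "y \<notin> Q" if "y \<sqsubset> w" for y
    using that w z' rank_le_trans[of y w z] rank_le_trans[of w z y] rank_le_trans[of z y w]
    unfolding tprec_def by blast
  with w show "\<exists>z\<in>Q. \<forall>y. (y, z) \<in> {(s, t). s \<sqsubset> t} \<longrightarrow> y \<notin> Q"
    by blast
qed

lemma tprec_induct [case_names less]: "(\<And>t. (\<And>s. s \<sqsubset> t \<Longrightarrow> P s) \<Longrightarrow> P t) \<Longrightarrow> P t"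
  using wf_induct_rule[OF wf_tprec, of P t] by auto

lemma child_tprec: "f n \<sqsubset> Node b f"
proof -
  have "\<not> rank_le (Node b f) (f n)"
    unfolding not_rank_le_iff using rank_le_refl by auto
  then show ?thesis
    by (simp add: tprec_def)
qed

text \<open>Leaves have rank zero and nodes positive rank, so the leaves form an initial segment of
  the order.\<close>

lemma tprec_LeafD: "t \<sqsubset> Leaf x \<Longrightarrow> \<exists>y. t = Leaf y"
  by (cases t) (auto simp: tprec_def)

section \<open>Encoding of trees as sequences of lists\<close>

text \<open>
  A tree is determined by the labels along its paths; the lengths 1, 0 and 2 tell leaves, limits
  and midpoints apart.
\<close>

primrec labels :: "'a ptree \<Rightarrow> nat list \<Rightarrow> 'a list" where
  "labels (Leaf x) = (\<lambda>p. [x])"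
| "labels (Node b f) =
     (\<lambda>p. case p of [] \<Rightarrow> if b then [] else [undefined, undefined] | n # q \<Rightarrow> labels (f n) q)"

lemma labels_inject: "labels s = labels t \<Longrightarrow> s = t"
proof (induction s arbitrary: t)
  case (Leaf x)
  then show ?case
    by (cases t) (auto dest!: fun_cong[of _ _ "[]"] split: if_splits)
next
  case (Node b f)
  show ?case
  proof (cases t)
    case (Leaf x)
    with Node.prems show ?thesis
      by (auto dest!: fun_cong[of _ _ "[]"] split: if_splits)
  next
    case t: (Node c g)
    have "labels (f n) = labels (g n)" for n
    proof
      fix q show "labels (f n) q = labels (g n) q"
        using fun_cong[OF Node.prems, of "n # q"] t by simp
    qed
    then have "f = g"
      using Node.IH by auto
    moreover have "b = c"
      using fun_cong[OF Node.prems, of "[]"] t by (auto split: if_splits)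
    ultimately show ?thesis
      using t by simp
  qed
qed

text \<open>Paths are countably many, so indexing them by naturals moves the labels into the point
  type demanded by the theorem.\<close>

definition encode :: "'a ptree \<Rightarrow> nat \<Rightarrow> 'a list" where
  "encode t = labels t \<circ> from_nat"

lemma inj_encode: "inj encode"
proof (rule injI)
  fix s t :: "'a ptree" assume "encode s = encode t"
  then have "encode s (to_nat p) = encode t (to_nat p)" for p :: "nat list"
    by simp
  then have "labels s p = labels t p" for p
    by (simp add: encode_def)
  then show "s = t"
    by (intro labels_inject ext)
qed

section \<open>Distances between trees, and the admissible trees\<close>

definition node_op :: "bool \<Rightarrow> (nat \<Rightarrow> real) \<Rightarrow> real" where
  "node_op b h = (if b then lim h else (h 0 + h 1) / 2)"

text \<open>Defined on all trees, including limit nodes over divergent sequences, where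
  \<open>lim\<close> is an unspecified value; \<open>trees\<close> excludes these afterwards. A node
  against a leaf needs no comparison, since nodes come after all leaves.\<close>

function tdist :: "('a \<Rightarrow> 'a \<Rightarrow> real) \<Rightarrow> 'a ptree \<Rightarrow> 'a ptree \<Rightarrow> real" where
  "tdist \<delta> (Leaf x) (Leaf y) = \<delta> x y"
| "tdist \<delta> (Leaf x) (Node c g) = node_op c (\<lambda>n. tdist \<delta> (Leaf x) (g n))"
| "tdist \<delta> (Node b f) (Leaf y) = node_op b (\<lambda>n. tdist \<delta> (f n) (Leaf y))"
| "tdist \<delta> (Node b f) (Node c g) =
     (if Node b f = Node c g then 0
      else if Node c g \<sqsubset> Node b f then node_op b (\<lambda>n. tdist \<delta> (f n) (Node c g))
      else node_op c (\<lambda>n. tdist \<delta> (Node b f) (g n)))"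
  by pat_completeness auto
termination
  \<comment> \<open>\<open>snd\<close> drops \<open>\<delta>\<close>; every recursive call replaces
    one of the two trees by a child and keeps the other.\<close>
  by (relation "inv_image ({(s, t). s \<in> children t} <*lex*> {(s, t). s \<in> children t}) snd")
    (auto simp: wf_children)

lemma tdist_commute:
  assumes "\<And>x y. \<delta> x y = \<delta> y x"
  shows "tdist \<delta> s t = tdist \<delta> t s"
  using assms
proof (induction \<delta> s t rule: tdist.induct)
  case (4 \<delta> b f c g)
  then show ?case
    using tprec_linear[of "Node b f" "Node c g"] tprec_asym[of "Node b f" "Node c g"]
    by (auto simp: eq_commute)
qed simp_all

lemma tdist_Node: "t \<sqsubset> Node b f \<Longrightarrow> tdist \<delta> (Node b f) t = node_op b (\<lambda>n. tdist \<delta> (f n) t)"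
  by (cases t) (auto simp: tprec_irrefl)

text \<open>Since \<open>tdist\<close> already exists on all trees, the Cauchy condition on limit
  nodes can be stated without defining points and distances simultaneously.\<close>

inductive_set trees :: "'a metric \<Rightarrow> 'a ptree set" for X where
  Leaf: "x \<in> mspace X \<Longrightarrow> Leaf x \<in> trees X"
| Node: "(\<And>n. f n \<in> trees X) \<Longrightarrow>
    (b \<Longrightarrow> \<forall>\<epsilon>>0. \<exists>N. \<forall>m\<ge>N. \<forall>n\<ge>N. tdist (mdist X) (f m) (f n) < \<epsilon>) \<Longrightarrow> Node b f \<in> trees X"

lemma Leaf_in_trees_iff: "Leaf x \<in> trees X \<longleftrightarrow> x \<in> mspace X"
  by (subst trees.simps) simp

lemma Node_in_trees_iff:
  "Node b f \<in> trees X \<longleftrightarrow> (\<forall>n. f n \<in> trees X) \<and>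
    (b \<longrightarrow> (\<forall>\<epsilon>>0. \<exists>N. \<forall>m\<ge>N. \<forall>n\<ge>N. tdist (mdist X) (f m) (f n) < \<epsilon>))"
  by (subst trees.simps) simp

section \<open>The triangle and Ptolemy inequalities on trees\<close>

text \<open>Limits and averages preserve affine inequalities. One shape serves both inequalities:
  the \<open>h\<close> are distances from the children of the expanded node, the coefficients come
  from distances between the other points.\<close>

lemma node_op_mono:
  assumes lim: "b \<Longrightarrow> convergent h1" "b \<Longrightarrow> convergent h2" "b \<Longrightarrow> convergent h3"
    and le: "\<And>n. h1 n * c1 \<le> h2 n * c2 + h3 n * c3 + c"
  shows "node_op b h1 * c1 \<le> node_op b h2 * c2 + node_op b h3 * c3 + c"
proof (cases b)
  case True
  have "(\<lambda>n. h1 n * c1) \<longlonglongrightarrow> lim h1 * c1"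
    using lim(1) True by (intro tendsto_intros) (simp add: convergent_LIMSEQ_iff)
  moreover have "(\<lambda>n. h2 n * c2 + h3 n * c3 + c) \<longlonglongrightarrow> lim h2 * c2 + lim h3 * c3 + c"
    using lim(2,3) True by (intro tendsto_intros) (simp_all add: convergent_LIMSEQ_iff)
  ultimately show ?thesis
    using True le by (auto simp: node_op_def intro: LIMSEQ_le)
next
  case False
  then show ?thesis
    using le[of 0] le[of 1] by (simp add: node_op_def algebra_simps add_divide_distrib)
qed

locale ptolemy_space =
  fixes X :: "'a metric"
  assumes ptolemy: "Ptolemy X"
begin

abbreviation d :: "'a ptree \<Rightarrow> 'a ptree \<Rightarrow> real" where
  "d \<equiv> tdist (mdist X)"

lemma d_commute: "d s t = d t s"
  by (rule tdist_commute) (rule mdist_commute)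

lemma d_self: "t \<in> trees X \<Longrightarrow> d t t = 0"
  by (erule trees.cases) auto

text \<open>Both inequalities go through the induction together: at a new node the Ptolemy
  inequality relies on the triangle inequality for convergence and nonnegativity.\<close>

definition triangle_ptolemy_on :: "'a ptree set \<Rightarrow> bool" where
  "triangle_ptolemy_on A \<longleftrightarrow>
     (\<forall>s\<in>A. \<forall>t\<in>A. \<forall>u\<in>A. d s u \<le> d s t + d t u) \<and>
     (\<forall>s\<in>A. \<forall>t\<in>A. \<forall>u\<in>A. \<forall>v\<in>A. d s t * d u v \<le> d s u * d t v + d s v * d t u)"

text \<open>As \<open>m\<close> is later than all of \<open>A\<close>, its distances to
  \<open>A\<close> expand over its children, which lie in \<open>A\<close>. Inequalities containing
  \<open>m\<close> once follow by \<open>node_op_mono\<close>; those with repeated \<open>m\<close>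
  reduce to symmetry, nonnegativity and zero self-distance.\<close>

lemma triangle_ptolemy_on_insert:
  assumes A: "A \<subseteq> trees X" "triangle_ptolemy_on A"
    and m: "m = Node b f" "m \<in> trees X"
    and f: "\<And>n. f n \<in> A" and less: "\<And>t. t \<in> A \<Longrightarrow> t \<sqsubset> m"
  shows "triangle_ptolemy_on (insert m A)"
proof -
  have tri: "d s u \<le> d s t + d t u" if "s \<in> A" "t \<in> A" "u \<in> A" for s t u
    using A(2) that unfolding triangle_ptolemy_on_def by blast
  have ptol: "d s t * d u v \<le> d s u * d t v + d s v * d t u"
    if "s \<in> A" "t \<in> A" "u \<in> A" "v \<in> A" for s t u v
    using A(2) that unfolding triangle_ptolemy_on_def by blast
  have self: "d s s = 0" if "s \<in> insert m A" for s
    using d_self A(1) m(2) that by blast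
  have dm: "d m t = node_op b (\<lambda>n. d (f n) t)" if "t \<in> A" for t
    using tdist_Node less[OF that] m(1) by blast
  \<comment> \<open>By the triangle inequality in \<open>A\<close>, distances to a fixed
    \<open>t\<close> differ by at most \<open>d (f i) (f j)\<close>.\<close>
  have conv: "convergent (\<lambda>n. d (f n) t)" if "b" "t \<in> A" for t
  proof (intro Cauchy_convergent CauchyI)
    fix e :: real assume "e > 0"
    moreover have "Node b f \<in> trees X"
      using m by simp
    ultimately obtain N where N: "\<forall>i\<ge>N. \<forall>j\<ge>N. d (f i) (f j) < e"
      using \<open>b\<close> unfolding Node_in_trees_iff by blast
    have "norm (d (f i) t - d (f j) t) < e" if "i \<ge> N" "j \<ge> N" for i j
    proof -
      have "d (f i) (f j) < e"
        using N that by blast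
      then show ?thesis
        using tri[OF f[of i] f[of j] \<open>t \<in> A\<close>] tri[OF f[of j] f[of i] \<open>t \<in> A\<close>]
          d_commute[of "f i" "f j"] by simp
    qed
    then show "\<exists>N. \<forall>i\<ge>N. \<forall>j\<ge>N. norm (d (f i) t - d (f j) t) < e"
      by blast
  qed
  have tri1: "d m u \<le> d m t + d t u" if "t \<in> A" "u \<in> A" for t u
  proof -
    have "node_op b (\<lambda>n. d (f n) u) * 1
        \<le> node_op b (\<lambda>n. d (f n) t) * 1 + node_op b (\<lambda>n. d (f n) t) * 0 + d t u"
      using tri[OF f that] by (intro node_op_mono conv that) auto
    then show ?thesis
      using that by (simp add: dm)
  qed
  have tri2: "d s u \<le> d m s + d m u" if "s \<in> A" "u \<in> A" for s u
  proof -
    have "d s u \<le> d (f n) s + d (f n) u" for n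
      using tri[OF that(1) f[of n] that(2)] d_commute[of s "f n"] by simp
    \<comment> \<open>Here \<open>m\<close> is the middle point and both its distances stand on the
      right: the left coefficient is 0 and \<open>d s u\<close> becomes the constant
      \<open>- d s u\<close>.\<close>
    then have "node_op b (\<lambda>n. d (f n) u) * 0
        \<le> node_op b (\<lambda>n. d (f n) s) * 1 + node_op b (\<lambda>n. d (f n) u) * 1 + - d s u"
      by (intro node_op_mono conv that) auto
    then show ?thesis
      using that by (simp add: dm)
  qed
  have ptol1: "d m t * d u v \<le> d m u * d t v + d m v * d t u"
    if "t \<in> A" "u \<in> A" "v \<in> A" for t u v
  proof -
    have "node_op b (\<lambda>n. d (f n) t) * d u v
        \<le> node_op b (\<lambda>n. d (f n) u) * d t v + node_op b (\<lambda>n. d (f n) v) * d t u + 0"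
      using ptol[OF f that] by (intro node_op_mono conv that) auto
    then show ?thesis
      using that by (simp add: dm)
  qed
  have nonneg_m: "0 \<le> d m t" if "t \<in> insert m A" for t
    using that tri2[of t t] self by fastforce
  have ptol_m: "d m t * d u v \<le> d m u * d t v + d m v * d t u"
    if t: "t \<in> insert m A" and u: "u \<in> insert m A" and v: "v \<in> insert m A" for t u v
  proof -
    \<comment> \<open>For \<open>t = m\<close> the left side vanishes and nonnegativity suffices;
      for \<open>u = m\<close> or \<open>v = m\<close> both sides are equal.\<close>
    consider "t = m" | "u = m" | "v = m" | "t \<in> A" "u \<in> A" "v \<in> A"
      using t u v by blast
    then show ?thesis
    proof cases
      case 1
      then show ?thesis
        using self[of m] nonneg_m[OF u] nonneg_m[OF v] by simp
    next
      case 2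
      then show ?thesis
        using self[of m] d_commute[of t m] by simp
    next
      case 3
      then show ?thesis
        using self[of m] d_commute[of t m] d_commute[of u m] by simp
    next
      case 4
      then show ?thesis
        by (rule ptol1)
    qed
  qed
  have "d s u \<le> d s t + d t u" if h: "s \<in> insert m A" "t \<in> insert m A" "u \<in> insert m A" for s t u
  proof -
    consider "s = t \<or> t = u" | "s = u" | "s = m" "t \<in> A" "u \<in> A" | "t = m" "s \<in> A" "u \<in> A"
      | "u = m" "s \<in> A" "t \<in> A" | "s \<in> A" "t \<in> A" "u \<in> A"
      using h by blast
    then show ?thesis
    proof cases
      case 1
      then show ?thesis using self h by auto
    next
      case 2
      have "0 \<le> d s t"
      proof (cases "s = m \<or> t = m")
        case True
        then show ?thesis
          using nonneg_m[OF h(1)] nonneg_m[OF h(2)] d_commute[of s t] by metis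
      next
        case False
        then show ?thesis
          using tri[of s t s] self[of s] h unfolding d_commute[of t s] by simp
      qed
      then show ?thesis
        using self[OF h(1)] unfolding 2[symmetric] d_commute[of t s] by simp
    next
      case 3
      then show ?thesis using tri1 by simp
    next
      case 4
      then show ?thesis using tri2[of s u] unfolding 4 d_commute[of s m] by simp
    next
      case 5
      then show ?thesis
        using tri1[of t s] unfolding 5 d_commute[of s m] d_commute[of t m] d_commute[of t s] by simp
    next
      case 6
      then show ?thesis by (rule tri)
    qed
  qed
  moreover have "d s t * d u v \<le> d s u * d t v + d s v * d t u"
    if h: "s \<in> insert m A" "t \<in> insert m A" "u \<in> insert m A" "v \<in> insert m A" for s t u v
  proof -
    \<comment> \<open>The inequality is invariant under swapping \<open>s\<close> with
      \<open>t\<close>, \<open>u\<close> with \<open>v\<close>, and the two pairs, so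
      \<open>m\<close> can be moved to the first position.\<close>
    consider "s = m" | "t = m" | "u = m" | "v = m" | "s \<in> A" "t \<in> A" "u \<in> A" "v \<in> A"
      using h by blast
    then show ?thesis
    proof cases
      case 1
      then show ?thesis using ptol_m h by blast
    next
      case 2
      then show ?thesis
        using ptol_m[OF h(1,3,4)] unfolding 2 d_commute[of s m] by (simp add: ac_simps)
    next
      case 3
      then show ?thesis
        using ptol_m[OF h(4,1,2)]
        unfolding 3 d_commute[of s m] d_commute[of t m] d_commute[of v s] d_commute[of v t]
        by (simp add: ac_simps)
    next
      case 4
      then show ?thesis
        using ptol_m[OF h(3,1,2)]
        unfolding 4 d_commute[of s m] d_commute[of t m] d_commute[of u m] d_commute[of u s]
          d_commute[of u t]
        by (simp add: ac_simps)
    next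
      case 5
      then show ?thesis by (rule ptol)
    qed
  qed
  ultimately show ?thesis
    unfolding triangle_ptolemy_on_def by blast
qed

lemma finite_tprec_max:
  "finite F \<Longrightarrow> F \<noteq> {} \<Longrightarrow> \<exists>x\<in>F. \<forall>y\<in>F. y \<sqsubset> x \<or> y = x"
proof (induction F rule: finite_ne_induct)
  case (insert a F)
  then obtain x where x: "x \<in> F" "\<forall>y\<in>F. y \<sqsubset> x \<or> y = x"
    by blast
  show ?case
  proof (cases "a \<sqsubset> x")
    case True
    with x show ?thesis
      by blast
  next
    case False
    then have "y \<sqsubset> a \<or> y = a" if "y \<in> F" for y
      using x(2) that tprec_linear[of a x] tprec_trans[of y x a] by blast
    then show ?thesis
      by blast
  qed
qed simp

text \<open>Each inequality involves at most four points, all of which lie in the initial segment of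
  the latest one.\<close>

lemma triangle_ptolemy_on_union:
  assumes "A \<subseteq> trees X"
    and "\<And>x. x \<in> A \<Longrightarrow> triangle_ptolemy_on {s \<in> trees X. s \<sqsubset> x \<or> s = x}"
  shows "triangle_ptolemy_on A"
proof -
  have *: "\<exists>B. F \<subseteq> B \<and> triangle_ptolemy_on B" if F: "finite F" "F \<noteq> {}" "F \<subseteq> A" for F
  proof -
    obtain x where x: "x \<in> F" "\<forall>y\<in>F. y \<sqsubset> x \<or> y = x"
      using finite_tprec_max[OF F(1,2)] by blast
    have "F \<subseteq> {s \<in> trees X. s \<sqsubset> x \<or> s = x}"
      using x F(3) assms(1) by blast
    moreover have "triangle_ptolemy_on {s \<in> trees X. s \<sqsubset> x \<or> s = x}"
      using x F(3) assms(2) by blast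
    ultimately show ?thesis
      by blast
  qed
  show ?thesis
    unfolding triangle_ptolemy_on_def
  proof (intro conjI ballI)
    fix s t u assume "s \<in> A" "t \<in> A" "u \<in> A"
    then obtain B where "{s, t, u} \<subseteq> B" "triangle_ptolemy_on B"
      using *[of "{s, t, u}"] by blast
    then show "d s u \<le> d s t + d t u"
      unfolding triangle_ptolemy_on_def by blast
  next
    fix s t u v assume "s \<in> A" "t \<in> A" "u \<in> A" "v \<in> A"
    then obtain B where "{s, t, u, v} \<subseteq> B" "triangle_ptolemy_on B"
      using *[of "{s, t, u, v}"] by blast
    then show "d s t * d u v \<le> d s u * d t v + d s v * d t u"
      unfolding triangle_ptolemy_on_def by blast
  qed
qed

lemma triangle_ptolemy_on_trees: "triangle_ptolemy_on (trees X)"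
proof -
  have "triangle_ptolemy_on {s \<in> trees X. s \<sqsubset> m \<or> s = m}" (is "triangle_ptolemy_on (?B m)") for m
  proof (induction m rule: tprec_induct)
    case (less m)
    \<comment> \<open>The segments up to each earlier tree give the open segment below
      \<open>m\<close>, to which only \<open>m\<close> itself has to be added.\<close>
    then have IH: "triangle_ptolemy_on {s \<in> trees X. s \<sqsubset> m}"
      by (rule triangle_ptolemy_on_union[rotated]) auto
    show ?case
    proof (cases "m \<in> trees X")
      case False
      then have "?B m = {s \<in> trees X. s \<sqsubset> m}"
        by blast
      with IH show ?thesis
        by simp
    next
      case True
      then show ?thesis
      proof cases
        case (Leaf x)
        have leaves: "\<exists>y \<in> mspace X. s = Leaf y" if "s \<in> ?B m" for s
        proof -
          have "s \<in> trees X"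
            using that by blast
          moreover have "s \<sqsubset> Leaf x \<or> s = Leaf x"
            using that Leaf by simp
          then obtain y where "s = Leaf y"
            using tprec_LeafD[of s x] by blast
          ultimately show ?thesis
            by (simp add: Leaf_in_trees_iff)
        qed
        show ?thesis
          unfolding triangle_ptolemy_on_def
        proof (intro conjI ballI)
          fix s t u assume "s \<in> ?B m" "t \<in> ?B m" "u \<in> ?B m"
          then obtain x y z where "s = Leaf x" "t = Leaf y" "u = Leaf z"
              "x \<in> mspace X" "y \<in> mspace X" "z \<in> mspace X"
            using leaves[of s] leaves[of t] leaves[of u] by blast
          then show "d s u \<le> d s t + d t u"
            by (simp add: mdist_triangle)
        next
          fix s t u v assume "s \<in> ?B m" "t \<in> ?B m" "u \<in> ?B m" "v \<in> ?B m"
          then obtain x y z w where "s = Leaf x" "t = Leaf y" "u = Leaf z" "v = Leaf w"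
              "x \<in> mspace X" "y \<in> mspace X" "z \<in> mspace X" "w \<in> mspace X"
            using leaves[of s] leaves[of t] leaves[of u] leaves[of v] by blast
          then show "d s t * d u v \<le> d s u * d t v + d s v * d t u"
            using ptolemy unfolding Ptolemy_def by simp
        qed
      next
        case (Node f b)
        then have "triangle_ptolemy_on (insert m {s \<in> trees X. s \<sqsubset> m})"
          using True child_tprec Node(2) by (intro triangle_ptolemy_on_insert[OF _ IH Node(1)]) auto
        moreover have "?B m = insert m {s \<in> trees X. s \<sqsubset> m}"
          using True by blast
        ultimately show ?thesis
          by simp
      qed
    qed
  qed
  then show ?thesis
    by (rule triangle_ptolemy_on_union[OF order_refl])
qed

end

section \<open>The metric quotient of a pseudometric\<close>

text \<open>Points at distance 0 are identified by choosing a representative \<open>r t\<close> of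
  each class. The class is named by the code \<open>e (r t)\<close>, so the quotient lives in the
  target type of \<open>e\<close> and not in a type of sets.\<close>

lemma pseudometric_quotient:
  fixes d :: "'b \<Rightarrow> 'b \<Rightarrow> real" and e :: "'b \<Rightarrow> 'c"
  assumes e: "inj_on e G"
    and commute: "\<And>s t. d s t = d t s"
    and self: "\<And>t. t \<in> G \<Longrightarrow> d t t = 0"
    and triangle: "\<And>s t u. s \<in> G \<Longrightarrow> t \<in> G \<Longrightarrow> u \<in> G \<Longrightarrow> d s u \<le> d s t + d t u"
  obtains Y :: "'c metric" and \<pi> where "mspace Y = \<pi> ` G"
    "\<And>s t. s \<in> G \<Longrightarrow> t \<in> G \<Longrightarrow> mdist Y (\<pi> s) (\<pi> t) = d s t"
proof -
  have nonneg: "0 \<le> d s t" if "s \<in> G" "t \<in> G" for s t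
    using triangle[OF that that(1)] self[OF that(1)] commute[of t s] by simp
  define r where "r t = (SOME s. s \<in> G \<and> d t s = 0)" for t
  have r: "r t \<in> G" "d t (r t) = 0" if "t \<in> G" for t
    using someI[of "\<lambda>s. s \<in> G \<and> d t s = 0" t] self[OF that] that unfolding r_def by auto
  have d_cong: "d s u = d t u" if "s \<in> G" "t \<in> G" "u \<in> G" "d s t = 0" for s t u
    using triangle[OF that(1,2,3)] triangle[OF that(2,1,3)] that(4) commute[of s t] by simp
  have r_cong: "r s = r t" if "s \<in> G" "t \<in> G" "d s t = 0" for s t
  proof -
    have "(\<lambda>u. u \<in> G \<and> d s u = 0) = (\<lambda>u. u \<in> G \<and> d t u = 0)"
      using d_cong[OF that(1,2) _ that(3)] by auto
    then show ?thesis
      unfolding r_def by simp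
  qed
  have d_r: "d (r s) (r t) = d s t" if "s \<in> G" "t \<in> G" for s t
  proof -
    have "d s t = d (r s) t"
      using d_cong[of s "r s" t] r that by simp
    also have "\<dots> = d t (r s)"
      by (rule commute)
    also have "\<dots> = d (r t) (r s)"
      using d_cong[of t "r t" "r s"] r that by simp
    finally show ?thesis
      using commute by simp
  qed
  define \<pi> where "\<pi> t = e (r t)" for t
  \<comment> \<open>\<open>Metric_space\<close> asks for nonnegativity at all arguments, also
    outside the carrier; hence the absolute value.\<close>
  define D where "D p q = \<bar>d (inv_into G e p) (inv_into G e q)\<bar>" for p q
  have D: "D (\<pi> s) (\<pi> t) = d s t" if "s \<in> G" "t \<in> G" for s t
    unfolding D_def \<pi>_def using that r e d_r nonneg by simp
  interpret Metric_space "\<pi> ` G" D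
  proof
    show "0 \<le> D p q" "D p q = D q p" for p q
      unfolding D_def using commute by auto
    show "D p q = 0 \<longleftrightarrow> p = q" if pq: "p \<in> \<pi> ` G" "q \<in> \<pi> ` G" for p q
    proof -
      obtain s t where st: "s \<in> G" "p = \<pi> s" "t \<in> G" "q = \<pi> t"
        using pq by blast
      show ?thesis
      proof
        assume "D p q = 0"
        then show "p = q"
          using st D r_cong[of s t] by (simp add: \<pi>_def)
      next
        assume "p = q"
        then show "D p q = 0"
          using st D[of s s] self by simp
      qed
    qed
    show "D p q \<le> D p p' + D p' q" if "p \<in> \<pi> ` G" "p' \<in> \<pi> ` G" "q \<in> \<pi> ` G" for p p' q
      using that by (auto simp: D triangle)
  qed
  show ?thesis
    by (rule that[of "metric (\<pi> ` G, D)" \<pi>]) (simp_all add: D)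
qed

section \<open>From midpoints and completeness to geodesics\<close>

context Metric_space
begin

text \<open>Points of \<open>A\<close> converging to \<open>t\<close> have a Cauchy image under the
  isometric \<open>\<phi>\<close>; its limit is \<open>p\<close>, and continuity of the distance
  gives the remaining equations.\<close>

lemma extend_partial_isometry:
  assumes "mcomplete" and "t \<in> closure A" and \<phi>: "\<And>a. a \<in> A \<Longrightarrow> \<phi> a \<in> M"
    and iso: "\<And>a b. a \<in> A \<Longrightarrow> b \<in> A \<Longrightarrow> d (\<phi> a) (\<phi> b) = \<bar>a - b :: real\<bar>"
  shows "\<exists>p \<in> M. \<forall>b \<in> A. d p (\<phi> b) = \<bar>t - b\<bar>"
proof -
  obtain s where s: "\<And>n. s n \<in> A" "s \<longlonglongrightarrow> t"
    using assms(2) unfolding closure_sequential by blast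
  have "MCauchy (\<lambda>n. \<phi> (s n))"
    unfolding MCauchy_def
  proof (intro conjI allI impI)
    fix e :: real assume "e > 0"
    moreover have "Cauchy s"
      using s(2) LIMSEQ_imp_Cauchy by blast
    ultimately obtain N where "\<forall>m\<ge>N. \<forall>n\<ge>N. norm (s m - s n) < e"
      using CauchyD by blast
    then show "\<exists>N. \<forall>n n'. N \<le> n \<longrightarrow> N \<le> n' \<longrightarrow> d (\<phi> (s n)) (\<phi> (s n')) < e"
      using iso s(1) by (intro exI[of _ N]) simp
  qed (use \<phi> s(1) in blast)
  then obtain p where p: "limitin mtopology (\<lambda>n. \<phi> (s n)) p sequentially"
    using assms(1) unfolding mcomplete_def by blast
  then have "p \<in> M"
    by (simp add: limitin_mspace)
  have lim: "(\<lambda>n. d (\<phi> (s n)) p) \<longlonglongrightarrow> 0"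
    using p by (simp add: limitin_metric_dist_null)
  have "d p (\<phi> b) = \<bar>t - b\<bar>" if b: "b \<in> A" for b
  proof -
    have "(\<lambda>n. d (\<phi> (s n)) (\<phi> b) - d p (\<phi> b)) \<longlonglongrightarrow> 0"
    proof (rule Lim_null_comparison[OF always_eventually lim], rule allI)
      fix n
      show "norm (d (\<phi> (s n)) (\<phi> b) - d p (\<phi> b)) \<le> d (\<phi> (s n)) p"
        using triangle[OF \<phi>[OF s(1)[of n]] \<open>p \<in> M\<close> \<phi>[OF b]]
          triangle[OF \<open>p \<in> M\<close> \<phi>[OF s(1)[of n]] \<phi>[OF b]]
        unfolding commute[of p "\<phi> (s n)"] by simp
    qed
    then have "(\<lambda>n. d (\<phi> (s n)) (\<phi> b)) \<longlonglongrightarrow> d p (\<phi> b)"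
      by (simp add: LIM_zero_iff)
    moreover have "(\<lambda>n. d (\<phi> (s n)) (\<phi> b)) \<longlonglongrightarrow> \<bar>t - b\<bar>"
      using iso s b by (auto intro!: tendsto_intros)
    ultimately show ?thesis
      by (rule LIMSEQ_unique)
  qed
  with \<open>p \<in> M\<close> show ?thesis
    by blast
qed

text \<open>For \<open>s \<le> a\<close> the triangle inequality through \<open>\<phi> a\<close>
  bounds \<open>d m (\<phi> s)\<close> above, and that for \<open>\<phi> b\<close>,
  \<open>m\<close>, \<open>\<phi> s\<close> bounds it below by the same value; the case
  \<open>b \<le> s\<close> is symmetric.\<close>

lemma extend_midpoint:
  assumes "a < b" and \<phi>: "\<And>a. a \<in> A \<Longrightarrow> \<phi> a \<in> M"
    and iso: "\<And>a b. a \<in> A \<Longrightarrow> b \<in> A \<Longrightarrow> d (\<phi> a) (\<phi> b) = \<bar>a - b :: real\<bar>"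
    and ab: "a \<in> A" "b \<in> A" "\<And>s. s \<in> A \<Longrightarrow> s \<le> a \<or> b \<le> s"
    and m: "m \<in> M" "d (\<phi> a) m = d (\<phi> a) (\<phi> b) / 2" "d m (\<phi> b) = d (\<phi> a) (\<phi> b) / 2"
    and s: "s \<in> A"
  shows "d m (\<phi> s) = \<bar>(a + b) / 2 - s\<bar>"
proof -
  have "d (\<phi> a) (\<phi> b) = b - a"
    using iso[OF ab(1,2)] \<open>a < b\<close> by simp
  then have m': "d m (\<phi> a) = (b - a) / 2" "d m (\<phi> b) = (b - a) / 2"
    using m(2,3) commute[of m "\<phi> a"] by simp_all
  have tri: "d m (\<phi> s) \<le> d m (\<phi> a) + d (\<phi> a) (\<phi> s)" "d m (\<phi> s) \<le> d m (\<phi> b) + d (\<phi> b) (\<phi> s)"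
    "d (\<phi> a) (\<phi> s) \<le> d m (\<phi> a) + d m (\<phi> s)" "d (\<phi> b) (\<phi> s) \<le> d m (\<phi> b) + d m (\<phi> s)"
    using triangle m(1) \<phi> ab s commute by metis+
  have "d (\<phi> a) (\<phi> s) = \<bar>a - s\<bar>" "d (\<phi> b) (\<phi> s) = \<bar>b - s\<bar>"
    using iso ab s by auto
  then show ?thesis
    using tri m' ab(3)[OF s] \<open>a < b\<close> by (auto simp: abs_if field_simps split: if_splits)
qed

text \<open>
  A maximal isometric map from a subset of the interval into the space that respects the endpoints
  has closed domain by completeness and no gaps by the existence of midpoints.
\<close>

lemma geodesic_if_midpoints:
  assumes complete: "mcomplete"
    and mid: "\<And>x y. x \<in> M \<Longrightarrow> y \<in> M \<Longrightarrow> \<exists>m\<in>M. d x m = d x y / 2 \<and> d m y = d x y / 2"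
    and xy: "x \<in> M" "y \<in> M"
  obtains \<gamma> where "\<gamma> ` {0..d x y} \<subseteq> M" "\<gamma> 0 = x" "\<gamma> (d x y) = y"
    "\<And>s t. s \<in> {0..d x y} \<Longrightarrow> t \<in> {0..d x y} \<Longrightarrow> d (\<gamma> s) (\<gamma> t) = \<bar>s - t\<bar>"
proof -
  define l where "l = d x y"
  \<comment> \<open>Partial maps are taken as graphs, so that Zorn's lemma applies to inclusion.
    Single-valuedness follows from the distance condition at \<open>a = b\<close>.\<close>
  define S where "S = {R. R \<subseteq> {0..l} \<times> M \<and> (0, x) \<in> R \<and> (l, y) \<in> R \<and>
    (\<forall>a p b q. (a, p) \<in> R \<longrightarrow> (b, q) \<in> R \<longrightarrow> d p q = \<bar>a - b\<bar>)}"
  have "{(0, x), (l, y)} \<in> S"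
    using xy by (auto simp: S_def l_def commute)
  then have "S \<noteq> {}"
    by blast
  moreover have "\<Union>C \<in> S" if "C \<noteq> {}" "subset.chain S C" for C
  proof -
    have CS: "C \<subseteq> S" and chain: "\<And>R R'. R \<in> C \<Longrightarrow> R' \<in> C \<Longrightarrow> R \<subseteq> R' \<or> R' \<subseteq> R"
      using that(2) by (auto simp: subset_chain_def)
    have "d p q = \<bar>a - b\<bar>" if ap: "(a, p) \<in> \<Union>C" and bq: "(b, q) \<in> \<Union>C" for a p b q
    proof -
      obtain R1 R2 where R12: "R1 \<in> C" "(a, p) \<in> R1" "R2 \<in> C" "(b, q) \<in> R2"
        using ap bq by blast
      then obtain R where "R \<in> C" "(a, p) \<in> R" "(b, q) \<in> R"
        using chain[OF R12(1,3)] by blast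
      moreover from this have "R \<in> S"
        using CS by blast
      ultimately show ?thesis
        unfolding S_def by blast
    qed
    moreover have "\<Union>C \<subseteq> {0..l} \<times> M" "(0, x) \<in> \<Union>C" "(l, y) \<in> \<Union>C"
      using CS \<open>C \<noteq> {}\<close> unfolding S_def by blast+
    ultimately show ?thesis
      unfolding S_def by blast
  qed
  ultimately obtain R where "R \<in> S" and max: "\<And>R'. R' \<in> S \<Longrightarrow> R \<subseteq> R' \<Longrightarrow> R' = R"
    using subset_Zorn_nonempty[of S] by blast
  then have R: "R \<subseteq> {0..l} \<times> M" "(0, x) \<in> R" "(l, y) \<in> R"
    and isoR: "\<And>a p b q. (a, p) \<in> R \<Longrightarrow> (b, q) \<in> R \<Longrightarrow> d p q = \<bar>a - b\<bar>"
    unfolding S_def by blast+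
  define A where "A = fst ` R"
  define \<phi> where "\<phi> a = (SOME p. (a, p) \<in> R)" for a
  have \<phi>R: "(a, \<phi> a) \<in> R" if "a \<in> A" for a
    using that unfolding A_def \<phi>_def by (auto intro: someI)
  have R\<phi>: "p = \<phi> a" if "(a, p) \<in> R" for a p
  proof -
    have "(a, \<phi> a) \<in> R"
      using that unfolding \<phi>_def by (rule someI)
    moreover from this have "d p (\<phi> a) = 0"
      using isoR[OF that] by simp
    ultimately show ?thesis
      using zero[of p "\<phi> a"] that R(1) by blast
  qed
  have \<phi>M: "\<phi> a \<in> M" and Al: "a \<in> {0..l}" if "a \<in> A" for a
    using \<phi>R[OF that] R(1) by blast+
  have iso: "d (\<phi> a) (\<phi> b) = \<bar>a - b\<bar>" if "a \<in> A" "b \<in> A" for a b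
    using isoR \<phi>R that by blast
  have ends: "0 \<in> A" "l \<in> A"
    using imageI[OF R(2), of fst] imageI[OF R(3), of fst] unfolding A_def by simp_all
  \<comment> \<open>Maximality of \<open>R\<close>: a parameter with a compatible image point could
    be added to the graph, so it is already in the domain.\<close>
  have ext: "t \<in> A" if h: "t \<in> {0..l}" "p \<in> M" "\<And>b. b \<in> A \<Longrightarrow> d p (\<phi> b) = \<bar>t - b\<bar>" for t p
  proof -
    have tp: "d p q = \<bar>t - b\<bar>" if bq: "(b, q) \<in> R" for b q
    proof -
      have "b \<in> A"
        using imageI[OF bq, of fst] unfolding A_def by simp
      with h(3) show ?thesis
        using R\<phi>[OF bq] by simp
    qed
    moreover have "d q p = \<bar>b - t\<bar>" if "(b, q) \<in> R" for b q
      using tp[OF that] commute[of q p] by (simp add: abs_minus_commute)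
    ultimately have "insert (t, p) R \<in> S"
      using R isoR h(1,2) unfolding S_def by auto
    then have tpR: "(t, p) \<in> R"
      using max by blast
    show ?thesis
      using imageI[OF tpR, of fst] unfolding A_def by simp
  qed
  have "closed A"
    unfolding closure_subset_eq[symmetric]
  proof
    fix t assume t: "t \<in> closure A"
    have "closure A \<subseteq> {0..l}"
      using Al by (intro closure_minimal) auto
    moreover obtain p where "p \<in> M" "\<forall>b \<in> A. d p (\<phi> b) = \<bar>t - b\<bar>"
      using extend_partial_isometry[OF complete t \<phi>M iso] by blast
    ultimately show "t \<in> A"
      using ext t by blast
  qed
  have A: "t \<in> A" if t: "t \<in> {0..l}" for t
  proof (rule ccontr)
    assume "t \<notin> A"
    \<comment> \<open>The gap of \<open>A\<close> around \<open>t\<close>: its ends belong to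
      \<open>A\<close> because \<open>A\<close> is closed and contains \<open>0\<close> and
      \<open>l\<close>.\<close>
    define a where "a = Sup (A \<inter> {..t})"
    define b where "b = Inf (A \<inter> {t..})"
    have bdd: "bdd_above (A \<inter> {..t})" "bdd_below (A \<inter> {t..})"
      by auto
    have "a \<in> A \<inter> {..t}"
      unfolding a_def using \<open>closed A\<close> ends t by (intro closed_contains_Sup) auto
    moreover have "b \<in> A \<inter> {t..}"
      unfolding b_def using \<open>closed A\<close> ends t by (intro closed_contains_Inf) auto
    ultimately have ab: "a \<in> A" "b \<in> A" "a < t" "t < b"
      using \<open>t \<notin> A\<close> by (auto simp: order_less_le)
    have gap: "s \<le> a \<or> b \<le> s" if "s \<in> A" for s
      using that cSup_upper[of s "A \<inter> {..t}"] cInf_lower[of s "A \<inter> {t..}"] bdd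
      unfolding a_def b_def by fastforce
    obtain m where m: "m \<in> M" "d (\<phi> a) m = d (\<phi> a) (\<phi> b) / 2" "d m (\<phi> b) = d (\<phi> a) (\<phi> b) / 2"
      using mid \<phi>M ab by metis
    have "(a + b) / 2 \<in> A"
    proof (rule ext[OF _ m(1)])
      show "(a + b) / 2 \<in> {0..l}"
        using Al[OF ab(1)] Al[OF ab(2)] by auto
      show "d m (\<phi> s) = \<bar>(a + b) / 2 - s\<bar>" if "s \<in> A" for s
        using ab by (intro extend_midpoint[OF _ \<phi>M iso _ _ gap m that]) auto
    qed
    then show False
      using gap ab by fastforce
  qed
  show ?thesis
  proof (rule that[of \<phi>])
    show "\<phi> ` {0..d x y} \<subseteq> M"
      using A \<phi>M unfolding l_def by blast
    show "\<phi> 0 = x" "\<phi> (d x y) = y"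
      using R\<phi> R unfolding l_def by auto
    show "d (\<phi> s) (\<phi> t) = \<bar>s - t\<bar>" if "s \<in> {0..d x y}" "t \<in> {0..d x y}" for s t
      using iso A that unfolding l_def by blast
  qed
qed

end

section \<open>Completeness and geodesics in the quotient of the tree space\<close>

theorem theorem1p1:
  fixes X :: "'a metric"
  assumes "Ptolemy X"
  shows "\<exists>(Y :: (nat \<Rightarrow> 'a list) metric) f.
           mcomplete_of Y \<and> geodesic_metric Y \<and> Ptolemy Y \<and> isometric_embedding X Y f"
proof -
  interpret ptolemy_space X
    by standard (rule assms)
  have tri: "d s u \<le> d s t + d t u" if "s \<in> trees X" "t \<in> trees X" "u \<in> trees X" for s t u
    using triangle_ptolemy_on_trees that unfolding triangle_ptolemy_on_def by blast
  obtain Y :: "(nat \<Rightarrow> 'a list) metric" and \<pi> where Y: "mspace Y = \<pi> ` trees X"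
    and \<pi>: "\<And>s t. s \<in> trees X \<Longrightarrow> t \<in> trees X \<Longrightarrow> mdist Y (\<pi> s) (\<pi> t) = d s t"
    using pseudometric_quotient[of encode "trees X" d, OF inj_on_subset[OF inj_encode subset_UNIV]
        d_commute d_self tri] by blast
  interpret Y: Metric_space "mspace Y" "mdist Y"
    by simp
  have "Ptolemy Y"
    unfolding Ptolemy_def Y
  proof (clarsimp simp: \<pi>)
    fix s t u v assume "s \<in> trees X" "t \<in> trees X" "u \<in> trees X" "v \<in> trees X"
    then show "d s t * d u v \<le> d s u * d t v + d s v * d t u"
      using triangle_ptolemy_on_trees unfolding triangle_ptolemy_on_def by blast
  qed
  moreover have "isometric_embedding X Y (\<lambda>x. \<pi> (Leaf x))"
    by (auto simp: isometric_embedding_def Y \<pi> Leaf_in_trees_iff)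
  moreover have complete: "Y.mcomplete"
    unfolding Y.mcomplete_def
  proof (intro allI impI)
    fix \<sigma> assume \<sigma>: "Y.MCauchy \<sigma>"
    then have \<sigma>Y: "\<sigma> n \<in> mspace Y" for n
      unfolding Y.MCauchy_def by blast
    \<comment> \<open>Trees representing the terms of the sequence; the formal limit
      \<open>Node True f\<close> will represent its limit.\<close>
    define f where "f n = inv_into (trees X) \<pi> (\<sigma> n)" for n
    have f: "f n \<in> trees X" "\<pi> (f n) = \<sigma> n" for n
      using \<sigma>Y[of n] unfolding Y f_def by (rule inv_into_into, rule f_inv_into_f)
    have df: "d (f m) (f n) = mdist Y (\<sigma> m) (\<sigma> n)" for m n
      using \<pi>[OF f(1) f(1), of m n] by (simp add: f(2))
    have cauchy: "\<forall>e>0. \<exists>N. \<forall>m\<ge>N. \<forall>n\<ge>N. d (f m) (f n) < e"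
    proof (intro allI impI)
      fix e :: real assume "e > 0"
      then obtain N where "\<forall>n n'. N \<le> n \<longrightarrow> N \<le> n' \<longrightarrow> mdist Y (\<sigma> n) (\<sigma> n') < e"
        using \<sigma> unfolding Y.MCauchy_def by presburger
      then show "\<exists>N. \<forall>m\<ge>N. \<forall>n\<ge>N. d (f m) (f n) < e"
        unfolding df by (intro exI[of _ N]) simp
    qed
    then have F: "Node True f \<in> trees X"
      using f(1) unfolding Node_in_trees_iff by blast
    have "\<exists>N. \<forall>n\<ge>N. \<sigma> n \<in> mspace Y \<and> mdist Y (\<sigma> n) (\<pi> (Node True f)) < e" if "e > 0" for e
    proof -
      \<comment> \<open>Half of \<open>e\<close>, because passing to the limit weakens the strict
        inequality.\<close>
      obtain N where N: "\<forall>m\<ge>N. \<forall>n\<ge>N. d (f m) (f n) < e / 2"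
        using cauchy half_gt_zero[OF \<open>e > 0\<close>] by blast
      have "mdist Y (\<sigma> n) (\<pi> (Node True f)) < e" if "n \<ge> N" for n
      proof -
        have "Cauchy (\<lambda>m. d (f m) (f n))"
        proof (rule CauchyI)
          fix c :: real assume "c > 0"
          then obtain K where K: "\<forall>i\<ge>K. \<forall>j\<ge>K. d (f i) (f j) < c"
            using cauchy by blast
          have "norm (d (f i) (f n) - d (f j) (f n)) \<le> d (f i) (f j)" for i j
            using tri[OF f(1)[of i] f(1)[of j] f(1)[of n]] tri[OF f(1)[of j] f(1)[of i] f(1)[of n]]
            unfolding d_commute[of "f j" "f i"] by simp
          with K show "\<exists>K. \<forall>i\<ge>K. \<forall>j\<ge>K. norm (d (f i) (f n) - d (f j) (f n)) < c"
            by (meson le_less_trans)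
        qed
        \<comment> \<open>Since \<open>f n\<close> is a child, it precedes the node, so the distance
          expands on the side of the node and is the limit of the distances from the
          children.\<close>
        then have "(\<lambda>m. d (f m) (f n)) \<longlonglongrightarrow> d (Node True f) (f n)"
          using tdist_Node[OF child_tprec[of f n True]]
          by (simp add: node_op_def Cauchy_convergent_iff convergent_LIMSEQ_iff)
        then have "d (Node True f) (f n) \<le> e / 2"
          using N \<open>n \<ge> N\<close> by (intro LIMSEQ_le_const2) (auto intro!: exI[of _ N] less_imp_le)
        then show ?thesis
          using \<pi>[OF f(1) F, of n] d_commute[of "f n" "Node True f"] \<open>e > 0\<close> by (simp add: f(2))
      qed
      with \<sigma>Y show ?thesis
        by blast
    qed
    moreover have "\<pi> (Node True f) \<in> mspace Y"
      using F Y by blast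
    ultimately show "\<exists>x. limitin Y.mtopology \<sigma> x sequentially"
      unfolding Y.limit_metric_sequentially by blast
  qed
  moreover have "geodesic_metric Y"
    unfolding geodesic_metric_def
  proof (intro ballI)
    fix x y assume xy: "x \<in> mspace Y" "y \<in> mspace Y"
    have mid: "\<exists>m\<in>mspace Y. mdist Y x m = mdist Y x y / 2 \<and> mdist Y m y = mdist Y x y / 2"
      if xy: "x \<in> mspace Y" "y \<in> mspace Y" for x y
    proof -
      obtain s t where st: "s \<in> trees X" "x = \<pi> s" "t \<in> trees X" "y = \<pi> t"
        using xy Y by auto
      \<comment> \<open>The midpoint is formed from the values at 0 and 1; repeating
        \<open>t\<close> keeps all further children admissible.\<close>
      define f where "f n = (if n = 0 then s else t)" for n :: nat
      have f: "f 0 = s" "f 1 = t" "\<And>n. f n \<in> trees X"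
        using st by (auto simp: f_def)
      have m: "Node False f \<in> trees X"
        using f unfolding Node_in_trees_iff by blast
      have dm: "d (Node False f) (f n) = (d s (f n) + d t (f n)) / 2" for n
        using tdist_Node[OF child_tprec[of f n False], of "mdist X"] f(1,2)
        by (simp add: node_op_def)
      have "d (Node False f) s = d s t / 2" "d (Node False f) t = d s t / 2"
        using dm[of 0] dm[of 1] f(1,2) d_self st d_commute[of t s] by simp_all
      then show ?thesis
        using st m \<pi> Y d_commute[of s "Node False f"] by (intro bexI[of _ "\<pi> (Node False f)"]) auto
    qed
    obtain \<gamma> where \<gamma>: "\<gamma> ` {0..mdist Y x y} \<subseteq> mspace Y" "\<gamma> 0 = x" "\<gamma> (mdist Y x y) = y"
      "\<And>s t. s \<in> {0..mdist Y x y} \<Longrightarrow> t \<in> {0..mdist Y x y} \<Longrightarrow> mdist Y (\<gamma> s) (\<gamma> t) = \<bar>s - t\<bar>"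
      using Y.geodesic_if_midpoints[OF complete mid xy] by blast
    then have "isometric_embedding (submetric euclidean_metric {0..mdist Y x y}) Y \<gamma>"
      by (auto simp: isometric_embedding_def dist_real_def)
    with \<gamma> show "\<exists>\<gamma>. isometric_embedding (submetric euclidean_metric {0..mdist Y x y}) Y \<gamma> \<and>
        \<gamma> 0 = x \<and> \<gamma> (mdist Y x y) = y"
      by blast
  qed
  ultimately show ?thesis
    unfolding mcomplete_of_def by blast
qed

end
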